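(* Let $\alpha$ be a confluent non-expansive partial action of a monoid $M$ on a weak pseudometric space $(X,d)$ (with a fixed witnessing confluent presentation $\langle G\mid R\rangle$ of $M$), and let $(Y,D)$ be its free (weak pseudometric) globalization. Suppose $\alpha$ is compact. If $X$ is a path space, then $Y$ is a path space.
   Context: A weak pseudometric on $X$ is a symmetric function $d:X\times X\to[0,\infty]$ satisfying the triangle inequality and $d(x,x)=0$. Topological notions refer to the topology induced by $d$. A (weak pseudometric) space is a path space if the distance between any two points is the infimum of the lengths of all (continuous) curves joining them (with $\inf\emptyset=\infty$). Partial action: a partial map $M\times X\to X$, $(u,x)\mapsto u\cdot x$, with $e\cdot x=x$ for all $x$ ($e$ the unit of $M$) and such that, whenever $v\cdot x$ is defined, $(uv)\cdot x$ is defined iff $u\cdot(v\cdot x)$ is defined, in which case they are equal. $\operatorname{dom}(u)$ is the set of $x\in X$ with $u\cdot x$ defined. It is non-expansive if $d(u\cdot x,u\cdot y)\le d(x,y)$ for all $u\in M$, $x,y\in\operatorname{dom}(u)$. It is compact if $\operatorname{dom}(g)$ is compact for every generator $g\in G$ of the fixed presentation. Globalization: $Y=(M\times X)/{\simeq}$, where $\simeq$ is the equivalence relation generated by $(uv,x)\sim(u,v\cdot x)$ whenever $v\cdot x$ is defined; $[u,x]$ is the class of $(u,x)$. $M$ acts on $Y$ by $u\cdot[v,x]=[uv,x]$. The distance $D(a,b)$ on $Y$ is the infimum (with $\inf\emptyset=\infty$) of $\sum_{j=1}^n d(x_j,y_j)$ over all finite sequences $((u_j,x_j,y_j))_{j=1}^n$,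 $n\ge1$, $u_j\in M$, $x_j,y_j\in X$, with $[u_1,x_1]=a$, $[u_j,y_j]=[u_{j+1},x_{j+1}]$ for $1\le j<n$, and $[u_n,y_n]=b$. Confluence: A monoid presentation $\langle G\mid R\rangle$ consists of a set $G$ and a set $R\subset G^*\times G^*$ of directed reduction rules $l\to r$ ($G^*$ is the set of finite words over $G$). It induces a one-step reduction $w_1lw_2\to w_1rw_2$ on $G^*$; the presented monoid is $G^*$ modulo the equivalence relation generated by $\to$. A word is normal if no one-step reduction applies to it; a normal form of $w$ is a normal word equivalent to $w$. The presentation is confluent if there is no infinite sequence of one-step reductions, every word has a unique normal form, and no rule has a left side consisting of a single letter. Given a presentation of $M$, one-step reduction on $G^*\times X$ is defined by $(g_n\dots g_1,x)\to(g_n\dots g_2,g_1\cdot x)$ whenever $g_1\cdot x$ is defined, and $(w_1,x)\to(w_2,x)$ whenever $w_1\to w_2$ in $G^*$; normality and normal forms are defined as before. The partial action is confluent if $M$ has a confluent presentation $\langle G\mid R\rangle$ such that every element of $G^*\times X$ has a unique normal form and, whenever $(g_n\dots g_1)\cdot x=y$ holds in $X$ (with $g_i\in G$), $(g_n\dots g_1,x)$ can be transformed into $((),y)$ by finitely many one-step reductions, where $()$ is the empty word. *)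

theory Defs
  imports "HOL-Analysis.Analysis"
begin

section \<open>Weak pseudometric spaces and path spaces\<close>

locale weak_pseudometric =
  fixes X :: "'a set" and d :: "'a \<Rightarrow> 'a \<Rightarrow> ennreal"
  assumes refl: "x \<in> X \<Longrightarrow> d x x = 0"
    and sym: "\<lbrakk>x \<in> X; y \<in> X\<rbrakk> \<Longrightarrow> d x y = d y x"
    and triangle: "\<lbrakk>x \<in> X; y \<in> X; z \<in> X\<rbrakk> \<Longrightarrow> d x z \<le> d x y + d y z"

definition wpm_topology :: "'a set \<Rightarrow> ('a \<Rightarrow> 'a \<Rightarrow> ennreal) \<Rightarrow> 'a topology" where
  "wpm_topology X d =
     topology (\<lambda>U. U \<subseteq> X \<and> (\<forall>x\<in>U. \<exists>e>0. \<forall>y\<in>X. d x y < e \<longrightarrow> y \<in> U))"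

lemma openin_wpm_topology:
  "openin (wpm_topology X d) U \<longleftrightarrow>
     U \<subseteq> X \<and> (\<forall>x\<in>U. \<exists>e>0. \<forall>y\<in>X. d x y < e \<longrightarrow> y \<in> U)"
proof -
  have "istopology (\<lambda>U. U \<subseteq> X \<and> (\<forall>x\<in>U. \<exists>e>0. \<forall>y\<in>X. d x y < e \<longrightarrow> y \<in> U))"
    unfolding istopology_def
  proof (intro conjI allI impI ballI)
    fix S T x
    assume S: "S \<subseteq> X \<and> (\<forall>x\<in>S. \<exists>e>0. \<forall>y\<in>X. d x y < e \<longrightarrow> y \<in> S)"
      and T: "T \<subseteq> X \<and> (\<forall>x\<in>T. \<exists>e>0. \<forall>y\<in>X. d x y < e \<longrightarrow> y \<in> T)"
    then show "S \<inter> T \<subseteq> X" by blast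
    assume x: "x \<in> S \<inter> T"
    from S x obtain e1 where "e1 > 0" "\<forall>y\<in>X. d x y < e1 \<longrightarrow> y \<in> S" by blast
    moreover from T x obtain e2 where "e2 > 0" "\<forall>y\<in>X. d x y < e2 \<longrightarrow> y \<in> T" by blast
    ultimately show "\<exists>e>0. \<forall>y\<in>X. d x y < e \<longrightarrow> y \<in> S \<inter> T"
      by (intro exI[of _ "min e1 e2"]) auto
  next
    fix K x
    assume K: "\<forall>S\<in>K. S \<subseteq> X \<and> (\<forall>x\<in>S. \<exists>e>0. \<forall>y\<in>X. d x y < e \<longrightarrow> y \<in> S)"
    then show "\<Union>K \<subseteq> X" by blast
    assume "x \<in> \<Union>K"
    then obtain S where S: "S \<in> K" "x \<in> S" by blast
    with K obtain e where "e > 0" "\<forall>y\<in>X. d x y < e \<longrightarrow> y \<in> S" by blast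
    with S(1) show "\<exists>e>0. \<forall>y\<in>X. d x y < e \<longrightarrow> y \<in> \<Union>K" by blast
  qed
  then show ?thesis
    by (simp add: wpm_topology_def topology_inverse')
qed

lemma topspace_wpm_topology [simp]: "topspace (wpm_topology X d) = X"
proof
  show "topspace (wpm_topology X d) \<subseteq> X"
    using openin_topspace[of "wpm_topology X d"] unfolding openin_wpm_topology by blast
  have "openin (wpm_topology X d) X"
    unfolding openin_wpm_topology using zero_less_one by blast
  then show "X \<subseteq> topspace (wpm_topology X d)"
    by (rule openin_subset)
qed

text \<open>
  Curves are parametrised over the unit interval.  Repeated partition points are allowed; they
  contribute nothing because \<open>d x x = 0\<close>.
\<close>
definition curve_length :: "('a \<Rightarrow> 'a \<Rightarrow> ennreal) \<Rightarrow> (real \<Rightarrow> 'a) \<Rightarrow> ennreal" where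
  "curve_length d c =
     Sup {\<Sum>i<n. d (c (t i)) (c (t (Suc i))) | (n :: nat) (t :: nat \<Rightarrow> real).
            mono_on {..n} t \<and> t 0 = 0 \<and> t n = 1}"

locale path_space = weak_pseudometric X d
  for X :: "'a set" and d :: "'a \<Rightarrow> 'a \<Rightarrow> ennreal" +
  assumes dist_eq_Inf_length: "\<lbrakk>x \<in> X; y \<in> X\<rbrakk> \<Longrightarrow>
    d x y = Inf {curve_length d c | c. pathin (wpm_topology X d) c \<and> c 0 = x \<and> c 1 = y}"

section \<open>Partial actions\<close>

text \<open>
  The partial map is encoded by \<open>None\<close> for ``undefined''; its values at points outside the
  carrier \<open>X\<close> are irrelevant.  The equality of options in the last axiom expresses that both
  sides are defined simultaneously and then agree.
\<close>
locale partial_action =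
  fixes X :: "'x set" and act :: "'m::monoid_mult \<Rightarrow> 'x \<Rightarrow> 'x option"
  assumes closed: "\<lbrakk>x \<in> X; act u x = Some y\<rbrakk> \<Longrightarrow> y \<in> X"
    and unit: "x \<in> X \<Longrightarrow> act 1 x = Some x"
    and mult: "\<lbrakk>x \<in> X; act v x = Some y\<rbrakk> \<Longrightarrow> act (u * v) x = act u y"

definition act_dom :: "'x set \<Rightarrow> ('m \<Rightarrow> 'x \<Rightarrow> 'x option) \<Rightarrow> 'm \<Rightarrow> 'x set" where
  "act_dom X act u = {x \<in> X. act u x \<noteq> None}"

definition non_expansive ::
  "'x set \<Rightarrow> ('x \<Rightarrow> 'x \<Rightarrow> ennreal) \<Rightarrow> ('m \<Rightarrow> 'x \<Rightarrow> 'x option) \<Rightarrow> bool" where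
  "non_expansive X d act \<longleftrightarrow>
     (\<forall>u. \<forall>x\<in>act_dom X act u. \<forall>y\<in>act_dom X act u.
        d (the (act u x)) (the (act u y)) \<le> d x y)"

section \<open>Presentations and confluence\<close>

definition normal :: "('a \<Rightarrow> 'a \<Rightarrow> bool) \<Rightarrow> 'a \<Rightarrow> bool" where
  "normal step a \<longleftrightarrow> \<not> (\<exists>b. step a b)"

definition normal_form_of :: "('a \<Rightarrow> 'a \<Rightarrow> bool) \<Rightarrow> 'a \<Rightarrow> 'a \<Rightarrow> bool" where
  "normal_form_of step a b \<longleftrightarrow> normal step b \<and> equivclp step a b"

inductive word_step :: "'g set \<Rightarrow> ('g list \<times> 'g list) set \<Rightarrow> 'g list \<Rightarrow> 'g list \<Rightarrow> bool"
  for G R where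
  "\<lbrakk>w1 \<in> lists G; w2 \<in> lists G; (l, r) \<in> R\<rbrakk>
     \<Longrightarrow> word_step G R (w1 @ l @ w2) (w1 @ r @ w2)"

text \<open>
  \<open>\<iota>\<close> sends a generator to the element of the monoid it represents, so that the word
  \<open>w\<close> represents \<open>prod_list (map \<iota> w)\<close>.  The two conditions say that this evaluation
  map induces an isomorphism from the presented monoid onto the whole monoid.
\<close>
definition presents ::
  "'g set \<Rightarrow> ('g list \<times> 'g list) set \<Rightarrow> ('g \<Rightarrow> 'm::monoid_mult) \<Rightarrow> bool" where
  "presents G R \<iota> \<longleftrightarrow>
     R \<subseteq> lists G \<times> lists G \<and>
     (\<forall>u. \<exists>w\<in>lists G. prod_list (map \<iota> w) = u) \<and>
     (\<forall>w\<in>lists G. \<forall>w'\<in>lists G.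
        prod_list (map \<iota> w) = prod_list (map \<iota> w') \<longleftrightarrow> equivclp (word_step G R) w w')"

definition confluent_presentation :: "'g set \<Rightarrow> ('g list \<times> 'g list) set \<Rightarrow> bool" where
  "confluent_presentation G R \<longleftrightarrow>
     \<not> (\<exists>f. \<forall>i::nat. word_step G R (f i) (f (Suc i))) \<and>
     (\<forall>w\<in>lists G. \<exists>!w'. normal_form_of (word_step G R) w w') \<and>
     (\<forall>(l, r)\<in>R. length l \<noteq> 1)"

text \<open>
  The word \<open>g\<^sub>n \<dots> g\<^sub>1\<close> is the list \<open>[g\<^sub>n, \<dots>, g\<^sub>1]\<close>,
  so it is the last letter that acts first.
\<close>
inductive action_step ::
  "'g set \<Rightarrow> ('g list \<times> 'g list) set \<Rightarrow> ('g \<Rightarrow> 'm) \<Rightarrow> 'x set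
     \<Rightarrow> ('m \<Rightarrow> 'x \<Rightarrow> 'x option) \<Rightarrow> 'g list \<times> 'x \<Rightarrow> 'g list \<times> 'x \<Rightarrow> bool"
  for G R \<iota> X act where
  apply_letter: "\<lbrakk>w \<in> lists G; g \<in> G; x \<in> X; act (\<iota> g) x = Some y\<rbrakk>
     \<Longrightarrow> action_step G R \<iota> X act (w @ [g], x) (w, y)"
| rewrite_word: "\<lbrakk>word_step G R w w'; x \<in> X\<rbrakk>
     \<Longrightarrow> action_step G R \<iota> X act (w, x) (w', x)"

definition confluent_partial_action ::
  "'g set \<Rightarrow> ('g list \<times> 'g list) set \<Rightarrow> ('g \<Rightarrow> 'm::monoid_mult) \<Rightarrow> 'x set
     \<Rightarrow> ('m \<Rightarrow> 'x \<Rightarrow> 'x option) \<Rightarrow> bool" where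
  "confluent_partial_action G R \<iota> X act \<longleftrightarrow>
     partial_action X act \<and>
     presents G R \<iota> \<and>
     confluent_presentation G R \<and>
     (\<forall>p \<in> lists G \<times> X. \<exists>!q. normal_form_of (action_step G R \<iota> X act) p q) \<and>
     (\<forall>w\<in>lists G. \<forall>x\<in>X. \<forall>y. act (prod_list (map \<iota> w)) x = Some y \<longrightarrow>
        (action_step G R \<iota> X act)\<^sup>*\<^sup>* (w, x) ([], y))"

definition compact_partial_action ::
  "'g set \<Rightarrow> ('g \<Rightarrow> 'm) \<Rightarrow> 'x set \<Rightarrow> ('x \<Rightarrow> 'x \<Rightarrow> ennreal)
     \<Rightarrow> ('m \<Rightarrow> 'x \<Rightarrow> 'x option) \<Rightarrow> bool" where
  "compact_partial_action G \<iota> X d act \<longleftrightarrow>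
     (\<forall>g\<in>G. compactin (wpm_topology X d) (act_dom X act (\<iota> g)))"

section \<open>The globalization\<close>

inductive glob_step ::
  "'x set \<Rightarrow> ('m::monoid_mult \<Rightarrow> 'x \<Rightarrow> 'x option) \<Rightarrow> 'm \<times> 'x \<Rightarrow> 'm \<times> 'x \<Rightarrow> bool"
  for X act where
  "\<lbrakk>x \<in> X; act v x = Some y\<rbrakk> \<Longrightarrow> glob_step X act (u * v, x) (u, y)"

definition glob_rel ::
  "'x set \<Rightarrow> ('m::monoid_mult \<Rightarrow> 'x \<Rightarrow> 'x option) \<Rightarrow> (('m \<times> 'x) \<times> ('m \<times> 'x)) set" where
  "glob_rel X act =
     {(p, q). p \<in> UNIV \<times> X \<and> q \<in> UNIV \<times> X \<and> equivclp (glob_step X act) p q}"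

definition glob_space ::
  "'x set \<Rightarrow> ('m::monoid_mult \<Rightarrow> 'x \<Rightarrow> 'x option) \<Rightarrow> ('m \<times> 'x) set set" where
  "glob_space X act = (UNIV \<times> X) // glob_rel X act"

definition glob_class ::
  "'x set \<Rightarrow> ('m::monoid_mult \<Rightarrow> 'x \<Rightarrow> 'x option) \<Rightarrow> 'm \<Rightarrow> 'x \<Rightarrow> ('m \<times> 'x) set" where
  "glob_class X act u x = glob_rel X act `` {(u, x)}"

lemma equiv_glob_rel: "equiv (UNIV \<times> X) (glob_rel X act)"
proof (rule equivI)
  show "refl_on (UNIV \<times> X) (glob_rel X act)"
    by (auto simp: refl_on_def glob_rel_def)
  show "sym (glob_rel X act)"
    by (auto simp: sym_def glob_rel_def intro: equivclp_sym)
  show "trans (glob_rel X act)"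
    by (auto simp: trans_def glob_rel_def intro: equivclp_trans)
qed (auto simp: glob_rel_def)

definition glob_dist ::
  "'x set \<Rightarrow> ('x \<Rightarrow> 'x \<Rightarrow> ennreal) \<Rightarrow> ('m::monoid_mult \<Rightarrow> 'x \<Rightarrow> 'x option)
     \<Rightarrow> ('m \<times> 'x) set \<Rightarrow> ('m \<times> 'x) set \<Rightarrow> ennreal" where
  "glob_dist X d act a b =
     Inf {\<Sum>j=1..n. d (x j) (y j) | (n :: nat) u x y.
            1 \<le> n \<and> (\<forall>j\<in>{1..n}. x j \<in> X \<and> y j \<in> X) \<and>
            glob_class X act (u 1) (x 1) = a \<and>
            (\<forall>j\<in>{1..<n}. glob_class X act (u j) (y j)
                           = glob_class X act (u (j + 1)) (x (j + 1))) \<and>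
            glob_class X act (u n) (y n) = b}"

end

theory Submission
  imports Defs
begin

text \<open>
  The distance \<open>D\<close> is the largest function on \<open>Y \<times> Y\<close> that vanishes on the diagonal, satisfies
  the triangle inequality and makes every map \<open>x \<mapsto> [u, x]\<close> non-expansive.  The induced length
  distance of \<open>D\<close> has these properties: non-expansive images of curves do not gain length,
  so if \<open>X\<close> is a path space then the length distance between \<open>[u, x]\<close> and \<open>[u, y]\<close> is at most
  \<open>d x y\<close>.  Hence it is bounded by \<open>D\<close>; the reverse inequality holds in every weak pseudometric space.
\<close>

section \<open>The induced length distance\<close>

definition length_dist :: "'a set \<Rightarrow> ('a \<Rightarrow> 'a \<Rightarrow> ennreal) \<Rightarrow> 'a \<Rightarrow> 'a \<Rightarrow> ennreal" where
  "length_dist X d x y =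
     Inf {curve_length d c | c. pathin (wpm_topology X d) c \<and> c 0 = x \<and> c 1 = y}"

text \<open>Elements within \<open>e / 2\<close> of the two infima exist when both infima are
  finite; otherwise the right side is \<open>top\<close>. This is how bounds for single curves or
  chains pass to distances, and an empty set counts as distance \<open>top\<close>.\<close>

lemma le_Inf_add_Inf:
  fixes x :: ennreal
  assumes le: "\<And>a b. \<lbrakk>a \<in> A; b \<in> B\<rbrakk> \<Longrightarrow> x \<le> a + b"
  shows "x \<le> Inf A + Inf B"
proof (rule ennreal_le_epsilon)
  fix e :: real
  assume fin: "Inf A + Inf B < top" and e: "0 < e"
  have "\<exists>s\<in>S. s < Inf S + ennreal (e / 2)" if "Inf S < top" for S :: "ennreal set"
    unfolding Inf_less_iff[symmetric] using that e by (cases "Inf S") simp_all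
  with fin obtain a b where "a \<in> A" "a < Inf A + ennreal (e / 2)"
    and "b \<in> B" "b < Inf B + ennreal (e / 2)"
    by (metis ennreal_add_less_top)
  then have "x \<le> (Inf A + ennreal (e / 2)) + (Inf B + ennreal (e / 2))"
    by (meson le add_mono less_imp_le order_trans)
  also have "\<dots> = Inf A + Inf B + (ennreal (e / 2) + ennreal (e / 2))"
    by (simp only: ac_simps)
  also have "ennreal (e / 2) + ennreal (e / 2) = ennreal e"
    using e by (simp flip: ennreal_plus)
  finally show "x \<le> Inf A + Inf B + ennreal e" .
qed

section \<open>Curve length and partitions\<close>

lemma curve_length_upper:
  "\<lbrakk>mono_on {..n} t; t 0 = 0; t n = 1\<rbrakk> \<Longrightarrow>
     (\<Sum>i<n. d (c (t i)) (c (t (Suc i)))) \<le> curve_length d c"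
  unfolding curve_length_def by (rule Sup_upper) blast

lemma curve_length_least:
  "(\<And>n t. \<lbrakk>mono_on {..n} t; t 0 = 0; t n = 1\<rbrakk> \<Longrightarrow>
      (\<Sum>i<n. d (c (t i)) (c (t (Suc i)))) \<le> L) \<Longrightarrow> curve_length d c \<le> L"
  unfolding curve_length_def by (rule Sup_least) blast

text \<open>The trivial partition of the unit interval, given by \<open>real\<close> with
  \<open>n = 1\<close>, already contributes the distance of the endpoints to the supremum.\<close>

lemma dist_le_curve_length: "d (c 0) (c 1) \<le> curve_length d c"
  using curve_length_upper[of 1 real d c] by (simp add: mono_on_def)

lemma dist_le_length_dist: "d x y \<le> length_dist X d x y"
  unfolding length_dist_def by (rule Inf_greatest) (use dist_le_curve_length in blast)

lemma length_dist_le: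
  "pathin (wpm_topology X d) c \<Longrightarrow> length_dist X d (c 0) (c 1) \<le> curve_length d c"
  unfolding length_dist_def by (rule Inf_lower) blast

lemma partition_in_unit_interval:
  fixes t :: "nat \<Rightarrow> real"
  assumes "mono_on {..n} t" "t 0 = 0" "t n = 1" "i \<le> n"
  shows "t i \<in> {0..1}"
  using assms by (metis atLeastAtMost_iff atMost_iff le0 mono_onD order_refl)

text \<open>A non-expansive map is continuous, since the same radius \<open>e\<close> serves on both
  sides, and it increases no partition sum. So composing with \<open>f\<close> turns competing
  curves in \<open>X\<close> into competing curves in \<open>Y\<close> that are no longer.\<close>

lemma length_dist_image_le:
  assumes f: "f \<in> X \<rightarrow> Y"
    and lip: "\<And>x y. \<lbrakk>x \<in> X; y \<in> X\<rbrakk> \<Longrightarrow> d' (f x) (f y) \<le> d x y"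
  shows "length_dist Y d' (f x) (f y) \<le> length_dist X d x y"
  unfolding length_dist_def[of X]
proof (rule Inf_greatest, clarify)
  fix c
  assume c: "pathin (wpm_topology X d) c"
  have cX: "c s \<in> X" if "s \<in> {0..1}" for s
    using path_image_subset_topspace[OF c] that by auto
  have "continuous_map (wpm_topology X d) (wpm_topology Y d') f"
    unfolding continuous_map_def
  proof (intro conjI allI impI)
    fix U
    assume U: "openin (wpm_topology Y d') U"
    have "\<exists>e>0. \<forall>y\<in>X. d x y < e \<longrightarrow> f y \<in> U" if "x \<in> X" "f x \<in> U" for x
    proof -
      from U that obtain e where "e > 0" and e: "\<forall>y\<in>Y. d' (f x) y < e \<longrightarrow> y \<in> U"
        unfolding openin_wpm_topology by blast
      moreover have "f y \<in> U" if "y \<in> X" "d x y < e" for y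
        using e f lip[OF \<open>x \<in> X\<close> that(1)] that by (meson Pi_mem le_less_trans)
      ultimately show ?thesis by blast
    qed
    then show "openin (wpm_topology X d) {x \<in> topspace (wpm_topology X d). f x \<in> U}"
      unfolding openin_wpm_topology by auto
  qed (use f in simp)
  with c have "pathin (wpm_topology Y d') (f \<circ> c)"
    by (rule pathin_compose)
  then have "length_dist Y d' (f (c 0)) (f (c 1)) \<le> curve_length d' (f \<circ> c)"
    using length_dist_le[of Y d' "f \<circ> c"] by simp
  also have "\<dots> \<le> curve_length d c"
  proof (rule curve_length_least)
    fix n and t :: "nat \<Rightarrow> real"
    assume t: "mono_on {..n} t" "t 0 = 0" "t n = 1"
    have "(\<Sum>i<n. d' ((f \<circ> c) (t i)) ((f \<circ> c) (t (Suc i)))) \<le>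
        (\<Sum>i<n. d (c (t i)) (c (t (Suc i))))"
      using partition_in_unit_interval[OF t] by (intro sum_mono) (simp add: lip cX)
    also have "\<dots> \<le> curve_length d c"
      by (rule curve_length_upper[OF t])
    finally show "(\<Sum>i<n. d' ((f \<circ> c) (t i)) ((f \<circ> c) (t (Suc i)))) \<le> curve_length d c" .
  qed
  finally show "length_dist Y d' (f (c 0)) (f (c 1)) \<le> curve_length d c" .
qed

section \<open>Concatenation of curves\<close>

definition join_curves :: "(real \<Rightarrow> 'a) \<Rightarrow> (real \<Rightarrow> 'a) \<Rightarrow> real \<Rightarrow> 'a" where
  "join_curves g h = (\<lambda>s. if s \<le> 1/2 then g (2 * s) else h (2 * s - 1))"

text \<open>Pasting along the two closed halves, which meet only in \<open>1/2\<close>; there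
  \<open>gh\<close> makes the branches agree.\<close>

lemma pathin_join_curves:
  assumes g: "pathin T g" and h: "pathin T h" and gh: "g 1 = h 0"
  shows "pathin T (join_curves g h)"
  unfolding pathin_def join_curves_def
proof (rule continuous_map_cases_le)
  let ?I = "top_of_set {0..1::real}"
  have "continuous_map (subtopology ?I {x \<in> topspace ?I. x \<le> 1/2}) ?I (\<lambda>x. 2 * x)"
    by (auto simp: continuous_map_in_subtopology continuous_map_from_subtopology
        intro!: continuous_intros)
  then show "continuous_map (subtopology ?I {x \<in> topspace ?I. x \<le> 1/2}) T (\<lambda>x. g (2 * x))"
    using continuous_map_compose g unfolding pathin_def o_def by blast
  have "continuous_map (subtopology ?I {x \<in> topspace ?I. 1/2 \<le> x}) ?I (\<lambda>x. 2 * x - 1)"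
    by (auto simp: continuous_map_in_subtopology continuous_map_from_subtopology
        intro!: continuous_intros)
  then show "continuous_map (subtopology ?I {x \<in> topspace ?I. 1/2 \<le> x}) T (\<lambda>x. h (2 * x - 1))"
    using continuous_map_compose h unfolding pathin_def o_def by blast
qed (auto simp: gh field_simps)

context weak_pseudometric
begin

lemma length_dist_refl:
  assumes x: "x \<in> X"
  shows "length_dist X d x x = 0"
proof -
  from x have "length_dist X d x x \<le> curve_length d (\<lambda>_. x)"
    using length_dist_le[of X d "\<lambda>_. x"] by simp
  also have "\<dots> \<le> 0"
    by (rule curve_length_least) (simp add: refl x)
  finally show ?thesis by simp
qed

text \<open>
  A partition \<open>t\<close> of the unit interval is mapped to the partitions \<open>min (2 t) 1\<close> and
  \<open>max (2 t - 1) 0\<close> for the two halves; this avoids locating the subinterval that contains \<open>1/2\<close>.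
\<close>
lemma curve_length_join_curves_le:
  assumes gX: "g \<in> {0..1} \<rightarrow> X" and hX: "h \<in> {0..1} \<rightarrow> X" and gh: "g 1 = h 0"
  shows "curve_length d (join_curves g h) \<le> curve_length d g + curve_length d h"
proof (rule curve_length_least)
  fix n and t :: "nat \<Rightarrow> real"
  assume t: "mono_on {..n} t" "t 0 = 0" "t n = 1"
  define p where "p = (\<lambda>s::real. min (2 * s) 1)"
  define q where "q = (\<lambda>s::real. max (2 * s - 1) 0)"
  have split: "d (join_curves g h a) (join_curves g h b) \<le> d (g (p a)) (g (p b)) + d (h (q a)) (h (q b))"
    if ab: "a \<in> {0..1}" "b \<in> {0..1}" "a \<le> b" for a b
  \<comment> \<open>Only a subinterval that straddles \<open>1/2\<close> needs the triangle
    inequality, through the common point \<open>g 1 = h 0\<close>. Otherwise one summand on the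
    right equals the left side.\<close>
  proof (cases "a \<le> 1/2 \<and> 1/2 < b")
    case True
    with ab have "g (2 * a) \<in> X" "g 1 \<in> X" "h (2 * b - 1) \<in> X"
      by (auto intro!: Pi_mem[OF gX] Pi_mem[OF hX])
    with True show ?thesis
      using triangle[of "g (2 * a)" "g 1" "h (2 * b - 1)"]
      by (simp add: join_curves_def p_def q_def min_def max_def gh)
  next
    case False
    with ab show ?thesis
      by (auto simp: join_curves_def p_def q_def min_def max_def)
  qed
  have "(\<Sum>i<n. d (join_curves g h (t i)) (join_curves g h (t (Suc i)))) \<le>
      (\<Sum>i<n. d (g (p (t i))) (g (p (t (Suc i)))) + d (h (q (t i))) (h (q (t (Suc i)))))"
    using partition_in_unit_interval[OF t] mono_onD[OF t(1)]
    by (intro sum_mono split) simp_all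
  also have "\<dots> = (\<Sum>i<n. d (g ((p \<circ> t) i)) (g ((p \<circ> t) (Suc i)))) +
      (\<Sum>i<n. d (h ((q \<circ> t) i)) (h ((q \<circ> t) (Suc i))))"
    by (simp add: sum.distrib)
  also have "\<dots> \<le> curve_length d g + curve_length d h"
  proof (intro add_mono curve_length_upper)
    show "mono_on {..n} (p \<circ> t)" "mono_on {..n} (q \<circ> t)"
      using t(1) by (force simp: mono_on_def p_def q_def min_def max_def)+
  qed (simp_all add: p_def q_def t)
  finally show "(\<Sum>i<n. d (join_curves g h (t i)) (join_curves g h (t (Suc i)))) \<le>
      curve_length d g + curve_length d h" .
qed

text \<open>Any curve from \<open>x\<close> to \<open>y\<close> can be concatenated with any curve
  from \<open>y\<close> to \<open>z\<close>, and lengths add up at most.\<close>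

lemma length_dist_triangle:
  "length_dist X d x z \<le> length_dist X d x y + length_dist X d y z"
  unfolding length_dist_def[of _ _ x y] length_dist_def[of _ _ y z]
proof (rule le_Inf_add_Inf, clarify)
  fix g h
  assume g: "pathin (wpm_topology X d) g" and h: "pathin (wpm_topology X d) h"
    and eq: "h 0 = g 1"
  have "length_dist X d (join_curves g h 0) (join_curves g h 1) \<le>
      curve_length d (join_curves g h)"
    by (intro length_dist_le pathin_join_curves g h eq[symmetric])
  also have "\<dots> \<le> curve_length d g + curve_length d h"
    using path_image_subset_topspace[OF g] path_image_subset_topspace[OF h] eq
    by (intro curve_length_join_curves_le) simp_all
  finally show "length_dist X d (g 0) (h 1) \<le> curve_length d g + curve_length d h"
    by (simp add: join_curves_def)
qed

end

section \<open>The globalization\<close>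

lemma glob_class_in_glob_space [intro]: "x \<in> X \<Longrightarrow> glob_class X act u x \<in> glob_space X act"
  unfolding glob_class_def glob_space_def by (simp add: quotientI)

lemma glob_spaceE:
  assumes "a \<in> glob_space X act"
  obtains u x where "x \<in> X" "a = glob_class X act u x"
  using assms unfolding glob_class_def glob_space_def by (auto elim: quotientE)

lemma glob_dist_class_le:
  assumes "x \<in> X" "y \<in> X"
  shows "glob_dist X d act (glob_class X act u x) (glob_class X act u y) \<le> d x y"
  unfolding glob_dist_def
  by (rule Inf_lower, rule CollectI,
      rule exI[of _ 1], rule exI[of _ "\<lambda>_. u"], rule exI[of _ "\<lambda>_. x"], rule exI[of _ "\<lambda>_. y"])
    (simp add: assms)

text \<open>This is the maximality of \<open>glob_dist\<close>, stated for one variable. Along a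
  chain, \<open>f\<close> grows by at most \<open>d (x j) (y j)\<close> within link \<open>j\<close>
  and does not change between links, because consecutive links meet in the same class.\<close>

lemma le_add_glob_dist:
  fixes f :: "('m::monoid_mult \<times> 'x) set \<Rightarrow> ennreal"
  assumes f: "\<And>u x y. \<lbrakk>x \<in> X; y \<in> X\<rbrakk> \<Longrightarrow>
      f (glob_class X act u y) \<le> f (glob_class X act u x) + d x y"
  shows "f b \<le> f a + glob_dist X d act a b"
proof -
  let ?c = "glob_class X act"
  have "f b \<le> f a + (\<Sum>j=1..n. d (x j) (y j))"
    if n: "1 \<le> n" and xy: "\<forall>j\<in>{1..n}. x j \<in> X \<and> y j \<in> X"
      and a: "?c (u 1) (x 1) = a" and b: "?c (u n) (y n) = b"
      and link: "\<forall>j\<in>{1..<n}. ?c (u j) (y j) = ?c (u (j + 1)) (x (j + 1))"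
    for n :: nat and u x y
  proof -
    \<comment> \<open>Induction runs over the initial segments of one fixed chain.\<close>
    have "f (?c (u k) (y k)) \<le> f a + (\<Sum>j=1..k. d (x j) (y j))" if "1 \<le> k" "k \<le> n" for k
      using that
    proof (induction k rule: dec_induct)
      case base
      with xy n a show ?case using f[of "x 1" "y 1" "u 1"] by simp
    next
      case (step k)
      have "f (?c (u (Suc k)) (y (Suc k))) \<le> f (?c (u (Suc k)) (x (Suc k))) + d (x (Suc k)) (y (Suc k))"
        using step xy by (intro f) auto
      also have "?c (u (Suc k)) (x (Suc k)) = ?c (u k) (y k)"
        using step link by simp
      also have "f (?c (u k) (y k)) \<le> f a + (\<Sum>j=1..k. d (x j) (y j))"
        using step by simp
      finally show ?case
        using step by (simp add: add.assoc add_right_mono)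
    qed
    from this[of n] n b show ?thesis by simp
  qed
  then have "f b \<le> Inf {f a} + glob_dist X d act a b"
    unfolding glob_dist_def by (intro le_Inf_add_Inf) blast
  then show ?thesis by simp
qed

text \<open>A chain that ends in the class of \<open>(u, x)\<close> can be extended by the link
  \<open>(u, x, y)\<close>. This is the hypothesis of \<open>le_add_glob_dist\<close> for the
  distance from \<open>a\<close>.\<close>

lemma glob_dist_snoc:
  assumes "x \<in> X" "y \<in> X"
  shows "glob_dist X d act a (glob_class X act u y) \<le>
      glob_dist X d act a (glob_class X act u x) + d x y"
proof -
  let ?c = "glob_class X act"
  have "glob_dist X d act a (?c u y) \<le> (\<Sum>j=1..n. d (p j) (q j)) + d x y"
    if n: "1 \<le> n" and pq: "\<forall>j\<in>{1..n}. p j \<in> X \<and> q j \<in> X"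
      and a: "?c (v 1) (p 1) = a" and b: "?c (v n) (q n) = ?c u x"
      and link: "\<forall>j\<in>{1..<n}. ?c (v j) (q j) = ?c (v (j + 1)) (p (j + 1))"
    for n :: nat and v p q
  proof -
    let ?v = "v(Suc n := u)" and ?p = "p(Suc n := x)" and ?q = "q(Suc n := y)"
    have "glob_dist X d act a (?c u y) \<le> (\<Sum>j=1..Suc n. d (?p j) (?q j))"
      unfolding glob_dist_def
    proof (rule Inf_lower, rule CollectI, rule exI[of _ "Suc n"], rule exI[of _ ?v],
        rule exI[of _ ?p], rule exI[of _ ?q], intro conjI)
      show "\<forall>j\<in>{1..<Suc n}. ?c (?v j) (?q j) = ?c (?v (j + 1)) (?p (j + 1))"
      proof
        fix j
        assume "j \<in> {1..<Suc n}"
        then show "?c (?v j) (?q j) = ?c (?v (j + 1)) (?p (j + 1))"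
          \<comment> \<open>The only new junction is at \<open>j = n\<close>, where \<open>b\<close>
            connects the old end to the added link.\<close>
          using link b by (cases "j = n") auto
      qed
    qed (use n pq a assms in auto)
    also have "(\<Sum>j=1..n. d (?p j) (?q j)) = (\<Sum>j=1..n. d (p j) (q j))"
      by (rule sum.cong) auto
    then have "(\<Sum>j=1..Suc n. d (?p j) (?q j)) = (\<Sum>j=1..n. d (p j) (q j)) + d x y"
      by simp
    finally show ?thesis .
  qed
  then have "glob_dist X d act a (?c u y) \<le> glob_dist X d act a (?c u x) + Inf {d x y}"
    unfolding glob_dist_def[of X d act a "?c u x"] by (intro le_Inf_add_Inf) blast
  then show ?thesis by simp
qed

lemma (in weak_pseudometric) weak_pseudometric_glob_dist:
  fixes act :: "'m::monoid_mult \<Rightarrow> 'a \<Rightarrow> 'a option"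
  shows "weak_pseudometric (glob_space X act) (glob_dist X d act)"
proof
  let ?c = "glob_class X act" and ?D = "glob_dist X d act"
  \<comment> \<open>Here \<open>le_add_glob_dist\<close> is applied to the function
    \<open>?D a\<close>.\<close>
  have triangle: "?D a c \<le> ?D a b + ?D b c" for a b c
    by (rule le_add_glob_dist, rule glob_dist_snoc)
  then show "?D a c \<le> ?D a b + ?D b c" for a b c .
  show refl: "?D a a = 0" if "a \<in> glob_space X act" for a
    using that by (elim glob_spaceE) (metis glob_dist_class_le le_zero_eq refl)
  have "?D b a \<le> ?D a b" if "a \<in> glob_space X act" for a b
  proof -
    \<comment> \<open>Applying maximality to the distance to \<open>a\<close> gives symmetry without
      reversing chains.\<close>
    have "?D b a \<le> ?D a a + ?D a b"
    proof (rule le_add_glob_dist)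
      fix u x y
      assume xy: "x \<in> X" "y \<in> X"
      have "?D (?c u y) a \<le> ?D (?c u y) (?c u x) + ?D (?c u x) a"
        by (rule triangle)
      also have "?D (?c u y) (?c u x) \<le> d x y"
        using xy glob_dist_class_le sym by metis
      finally show "?D (?c u y) a \<le> ?D (?c u x) a + d x y"
        by (simp add: add.commute add_right_mono)
    qed
    then show ?thesis by (simp add: refl that)
  qed
  then show "?D a b = ?D b a" if "a \<in> glob_space X act" "b \<in> glob_space X act" for a b
    using that by (intro antisym)
qed

theorem corollary5p23:
  fixes X :: "'x set"
    and d :: "'x \<Rightarrow> 'x \<Rightarrow> ennreal"
    and act :: "'m::monoid_mult \<Rightarrow> 'x \<Rightarrow> 'x option"
    and G :: "'g set"
    and R :: "('g list \<times> 'g list) set"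
    and \<iota> :: "'g \<Rightarrow> 'm"
  assumes "weak_pseudometric X d"
    and "confluent_partial_action G R \<iota> X act"
    and "non_expansive X d act"
    and "compact_partial_action G \<iota> X d act"
    and "path_space X d"
  shows "path_space (glob_space X act) (glob_dist X d act)"
proof -
  let ?Y = "glob_space X act" and ?D = "glob_dist X d act" and ?c = "glob_class X act"
  interpret X: path_space X d by fact
  interpret Y: weak_pseudometric ?Y ?D
    by (rule X.weak_pseudometric_glob_dist)
  have class_le: "length_dist ?Y ?D (?c u x) (?c u y) \<le> d x y" if "x \<in> X" "y \<in> X" for u x y
  proof -
    have "length_dist ?Y ?D (?c u x) (?c u y) \<le> length_dist X d x y"
      by (rule length_dist_image_le) (auto intro: glob_dist_class_le)
    also have "\<dots> = d x y"
      using X.dist_eq_Inf_length[OF that] by (simp add: length_dist_def)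
    finally show ?thesis .
  qed
  show ?thesis
  proof
    fix a b
    assume a: "a \<in> ?Y"
    \<comment> \<open>Maximality again, now for the length distance from \<open>a\<close>, which
      vanishes at \<open>a\<close> and grows by at most \<open>d x y\<close> from
      \<open>?c u x\<close> to \<open>?c u y\<close> by \<open>class_le\<close>.\<close>
    have "length_dist ?Y ?D a b \<le> length_dist ?Y ?D a a + ?D a b"
    proof (rule le_add_glob_dist)
      fix u x y
      assume "x \<in> X" "y \<in> X"
      then show "length_dist ?Y ?D a (?c u y) \<le> length_dist ?Y ?D a (?c u x) + d x y"
        by (meson Y.length_dist_triangle class_le add_left_mono order_trans)
    qed
    then have "length_dist ?Y ?D a b \<le> ?D a b"
      by (simp add: Y.length_dist_refl a)
    then show "?D a b = Inf {curve_length ?D c | c.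
        pathin (wpm_topology ?Y ?D) c \<and> c 0 = a \<and> c 1 = b}"
      using dist_le_length_dist[of ?D a b ?Y] unfolding length_dist_def by (rule antisym[rotated])
  qed
qed

end
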